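(* Let $\alpha\in\mathbb R$ and let $K_Y$ be defined from $K_Z$ by $$K_Y(t,u)=\alpha\int_u^te^{\alpha(t-s)}K_Z(s,u)\,ds+K_Z(t,u),\qquad 0\le u\le t.$$ If $K_Z$ is such that $K_Z(u,u)=0$ and $K_Z$ is differentiable in the first variable, with $\frac{\partial K_Z(s,u)}{\partial s}$ Lebesgue integrable in $s$, then $$K_Y(t,u)=\int_u^te^{\alpha(t-s)}\frac{\partial K_Z(s,u)}{\partial s}\,ds .$$
   Context: $K_Z(s,u)$, $0\le u\le s$, is a real deterministic Volterra kernel with $\int_0^tK_Z^2(t,s)\,ds<\infty$ for every $t>0$. $K_Y$ is the kernel of the Ornstein-Uhlenbeck process $Y_t=\alpha\int_0^tY_s\,ds+Z_t$ driven by the Gaussian Volterra process $Z_t=\int_0^tK_Z(t,s)\,dW_s$, $W$ a one-dimensional Wiener process, so that $Y_t=\int_0^tK_Y(t,u)\,dW_u$. Differentiability and integrability in the first variable $s$ refer to the range $u\le s\le t$. *)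

theory Defs
  imports "HOL-Analysis.Analysis"
begin

text \<open>
  A kernel is a total function on pairs of reals, but it only matters on \<open>0 \<le> u \<le> s\<close>.
  The condition says that \<open>K t\<close> belongs to \<open>L\<^sup>2\<close> on \<open>[0, t]\<close>.  Measurability is stated separately
  because integrability of the square does not imply it.
\<close>

definition volterra_kernel :: "(real \<Rightarrow> real \<Rightarrow> real) \<Rightarrow> bool" where
  "volterra_kernel K \<longleftrightarrow>
     (\<forall>t>0. set_borel_measurable lebesgue {0..t} (K t) \<and>
            set_integrable lebesgue {0..t} (\<lambda>s. (K t s)\<^sup>2))"

definition ou_kernel :: "real \<Rightarrow> (real \<Rightarrow> real \<Rightarrow> real) \<Rightarrow> real \<Rightarrow> real \<Rightarrow> real" where
  "ou_kernel \<alpha> K t u = \<alpha> * (LINT s:{u..t}|lebesgue. exp (\<alpha> * (t - s)) * K s u) + K t u"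

text \<open>
  The partial derivative in the first variable at \<open>(s, u)\<close>, for \<open>s\<close> ranging over \<open>[u, t]\<close>.
  It is one-sided at the endpoints, since \<open>K\<close> is not constrained at \<open>(s, u)\<close> with \<open>s < u\<close>.
  For \<open>u = t\<close> its value is meaningless, but then it is only ever integrated over \<open>{t}\<close>.
\<close>

definition kernel_deriv :: "(real \<Rightarrow> real \<Rightarrow> real) \<Rightarrow> real \<Rightarrow> real \<Rightarrow> real \<Rightarrow> real" where
  "kernel_deriv K t s u = vector_derivative (\<lambda>r. K r u) (at s within {u..t})"

end

theory Submission
  imports Defs
begin

text \<open>
  The function \<open>F s = exp (\<alpha> * (t - s)) * K s u\<close> vanishes at \<open>s = u\<close> and equals \<open>K t u\<close> at \<open>s = t\<close>,
  so integrating \<open>F'\<close> over \<open>[u, t]\<close> expresses \<open>K t u\<close> through the two integrals in the claim.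
  The derivative of \<open>K\<close> need not be continuous; the fundamental theorem is that of the
  Henstock-Kurzweil integral, and both summands of \<open>F'\<close> are Lebesgue integrable.
\<close>

lemma ou_kernel_eq_integral_deriv:
  fixes \<alpha> t u :: real
  assumes "u \<le> t" and diag: "K u u = 0"
    and diff: "(\<lambda>s. K s u) differentiable_on {u..t}"
    and int: "set_integrable lebesgue {u..t} (\<lambda>s. kernel_deriv K t s u)"
  shows "ou_kernel \<alpha> K t u = (LINT s:{u..t}|lebesgue. exp (\<alpha> * (t - s)) * kernel_deriv K t s u)"
proof -
  define E where "E s = exp (\<alpha> * (t - s))" for s
  define D where "D s = kernel_deriv K t s u" for s
  have contE: "continuous_on {u..t} E"
    unfolding E_def by (intro continuous_intros)
  have K_integrable: "set_integrable lebesgue {u..t} (\<lambda>s. E s * K s u)"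
    by (intro absolutely_integrable_continuous_real continuous_on_mult contE
        differentiable_imp_continuous_on diff)
  have D_integrable: "set_integrable lebesgue {u..t} (\<lambda>s. E s * D s)"
  proof (rule absolutely_integrable_bounded_measurable_product_real)
    show "E \<in> borel_measurable (lebesgue_on {u..t})"
      by (rule continuous_imp_measurable_on_sets_lebesgue[OF contE]) simp
    show "bounded (E ` {u..t})"
      by (intro compact_imp_bounded compact_continuous_image contE) simp
    show "set_integrable lebesgue {u..t} D"
      using int by (simp add: D_def[abs_def])
  qed simp
  have "((\<lambda>s. E s * D s + - \<alpha> * (E s * K s u)) has_integral E t * K t u - E u * K u u) {u..t}"
  proof (rule fundamental_theorem_of_calculus[OF \<open>u \<le> t\<close>])
    fix s assume "s \<in> {u..t}"
    \<comment> \<open>For \<open>u = t\<close> derivatives within \<open>{u..t}\<close> are not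
      unique, but \<open>vector_derivative\<close> still chooses a valid one, so this case needs no
      separate treatment.\<close>
    then have K': "((\<lambda>r. K r u) has_vector_derivative D s) (at s within {u..t})"
      using diff unfolding D_def kernel_deriv_def differentiable_on_def
      by (simp flip: vector_derivative_works)
    have "(E has_real_derivative - \<alpha> * E s) (at s within {u..t})"
      unfolding E_def by (auto intro!: derivative_eq_intros)
    from has_vector_derivative_mult[OF this[unfolded has_real_derivative_iff_has_vector_derivative] K']
    show "((\<lambda>r. E r * K r u) has_vector_derivative E s * D s + - \<alpha> * (E s * K s u)) (at s within {u..t})"
      by (simp add: algebra_simps)
  qed
  \<comment> \<open>Only the upper boundary term survives: \<open>E t = 1\<close> and
    \<open>K u u = 0\<close>.\<close>
  then have "K t u = integral {u..t} (\<lambda>s. E s * D s + - \<alpha> * (E s * K s u))"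
    by (simp add: diag E_def integral_unique)
  \<comment> \<open>Absolute integrability of the sum lets the Henstock-Kurzweil integral be read as
    a Lebesgue integral, which is then split.\<close>
  also have "\<dots> = (LINT s:{u..t}|lebesgue. E s * D s + - \<alpha> * (E s * K s u))"
    by (intro set_lebesgue_integral_eq_integral(2)[symmetric] set_integral_add(1)
        D_integrable set_integrable_mult_right K_integrable)
  also have "\<dots> = (LINT s:{u..t}|lebesgue. E s * D s) - \<alpha> * (LINT s:{u..t}|lebesgue. E s * K s u)"
    using set_integral_add(2)[OF D_integrable set_integrable_mult_right[OF K_integrable, of "- \<alpha>"]]
    by (simp add: set_lebesgue_integral_def mult.left_commute)
  \<comment> \<open>Moving the \<open>\<alpha>\<close> term to the side of \<open>K t u\<close>
    produces the kernel.\<close>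
  finally show ?thesis
    by (simp add: ou_kernel_def E_def D_def)
qed

theorem lemma15:
  fixes \<alpha> t :: real
    and K_Z K_Y :: "real \<Rightarrow> real \<Rightarrow> real"
  assumes "volterra_kernel K_Z"
    and "\<And>s u. 0 \<le> u \<Longrightarrow> u \<le> s \<Longrightarrow> K_Y s u = ou_kernel \<alpha> K_Z s u"
    and "\<And>u. 0 \<le> u \<Longrightarrow> u \<le> t \<Longrightarrow> K_Z u u = 0"
    and "\<And>u. 0 \<le> u \<Longrightarrow> u \<le> t \<Longrightarrow> (\<lambda>s. K_Z s u) differentiable_on {u..t}"
    and "\<And>u. 0 \<le> u \<Longrightarrow> u \<le> t \<Longrightarrow>
           set_integrable lebesgue {u..t} (\<lambda>s. kernel_deriv K_Z t s u)"
  shows "\<forall>u. 0 \<le> u \<and> u \<le> t \<longrightarrow>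
           K_Y t u = (LINT s:{u..t}|lebesgue. exp (\<alpha> * (t - s)) * kernel_deriv K_Z t s u)"
  using assms(2-5) by (simp add: ou_kernel_eq_integral_deriv)

end
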